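(* Let $b \ge 2$ and $s \ge 3$ be integers, let $\boldsymbol{e}=(e_1,\ldots,e_s)\in\mathbb{N}^s$ with $e_1\le e_2\le\cdots\le e_s$, and let $g$ be an integer with $1 \le g \le (s-1)/2$. If there exists a $(0,m,\boldsymbol{e},s)$-net in base $b$ with $m\ge e_{s-2g} + \cdots + e_{s-1}+ e_s$, then necessarily $$ \sum_{j=1}^g \ \sum_{1 \le i_1 < \cdots < i_j \le s} (b^{e_{i_1}}-1) \cdots (b^{e_{i_j}}-1) +(b^{e_s}-1) \sum_{1 \le i_1 < \cdots < i_g \le s-1} (b^{e_{i_1}}-1) \cdots (b^{e_{i_g}}-1) \le b^m -1. $$
   Context: $\mathbb{N}$ denotes the set of positive integers and $\lambda_s$ the $s$-dimensional Lebesgue measure. Elementary interval: for integers $b\ge 2$, $s\ge 1$, an interval $J\subseteq[0,1)^s$ is an elementary interval in base $b$ if $J=\prod_{i=1}^s [a_ib^{-d_i},(a_i+1)b^{-d_i})$ with integers $d_i\ge 0$ and $0\le a_i<b^{d_i}$ for $1\le i\le s$. $(u,m,\boldsymbol{e},s)$-net: let $b\ge 2$, $s\ge 1$, $0\le u\le m$ be integers and $\boldsymbol{e}=(e_1,\ldots,e_s)\in\mathbb{N}^s$. A point set $\mathcal{P}$ of $b^m$ points in $[0,1)^s$ (an indexed family; points are counted with multiplicity) is a $(u,m,\boldsymbol{e},s)$-net in base $b$ if every elementary interval $J=\prod_{i=1}^s [a_ib^{-d_i},(a_i+1)b^{-d_i})$ in base $b$, with integers $d_i\ge 0$, $0\le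 a_i<b^{d_i}$ and $e_i\mid d_i$ for $1\le i\le s$ and with volume $\lambda_s(J)\ge b^{u-m}$, contains exactly $b^m\lambda_s(J)$ points of $\mathcal{P}$. *)

theory Defs
  imports "HOL-Analysis.Analysis"
begin

(* Points of [0,1)^s are extensional functions on the index set {1..s}, so that s may be an
   ordinary natural number; values of e, d and a outside {1..s} are irrelevant. *)

definition unit_cube :: "nat \<Rightarrow> (nat \<Rightarrow> real) set" where
  "unit_cube s = (\<Pi>\<^sub>E i\<in>{1..s}. {0..<1})"

definition lebesgue_volume :: "nat \<Rightarrow> (nat \<Rightarrow> real) set \<Rightarrow> real" where
  "lebesgue_volume s A = measure (\<Pi>\<^sub>M i\<in>{1..s}. lborel) A"

definition elementary_box ::
  "nat \<Rightarrow> nat \<Rightarrow> (nat \<Rightarrow> nat) \<Rightarrow> (nat \<Rightarrow> nat) \<Rightarrow> (nat \<Rightarrow> real) set" where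
  "elementary_box b s d a =
     (\<Pi>\<^sub>E i\<in>{1..s}. {real (a i) / real b ^ d i ..< (real (a i) + 1) / real b ^ d i})"

(* The point set is the indexed family (P n), n < b^m; points are counted with multiplicity. *)

definition is_net ::
  "nat \<Rightarrow> nat \<Rightarrow> (nat \<Rightarrow> nat) \<Rightarrow> nat \<Rightarrow> nat \<Rightarrow> (nat \<Rightarrow> nat \<Rightarrow> real) \<Rightarrow> bool" where
  "is_net u m e s b P \<longleftrightarrow>
     2 \<le> b \<and> 1 \<le> s \<and> u \<le> m \<and> (\<forall>i\<in>{1..s}. 1 \<le> e i) \<and>
     (\<forall>n<b ^ m. P n \<in> unit_cube s) \<and>
     (\<forall>d a. (\<forall>i\<in>{1..s}. a i < b ^ d i \<and> e i dvd d i) \<longrightarrow>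
        lebesgue_volume s (elementary_box b s d a) \<ge> real b powi (int u - int m) \<longrightarrow>
        real (card {n. n < b ^ m \<and> P n \<in> elementary_box b s d a})
          = real b ^ m * lebesgue_volume s (elementary_box b s d a))"

end

theory Submission
  imports Defs
begin

text \<open>
  The inequality is Rao's bound for orthogonal arrays of odd strength \<open>2g + 1\<close> with mixed
  levels. Write \<open>q\<^sub>i = b ^ e i\<close> and \<open>N = b ^ m\<close>, and cut the \<open>i\<close>-th axis into
  \<open>q\<^sub>i\<close> cells of equal length. For a set \<open>K\<close> of at most \<open>2g + 1\<close> coordinates, the exponents
  \<open>e i\<close> with \<open>i \<in> K\<close> sum to at most the sum of the \<open>2g + 1\<close> largest ones, hence to at most
  \<open>m\<close>. The net property therefore applies to every box that prescribes the cells of the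
  coordinates in \<open>K\<close>: it contains exactly \<open>N / \<Prod>\<^bsub>i\<in>K\<^esub> q\<^sub>i\<close> points
  (\<open>net_cells_independent\<close>).

  Fix one point \<open>x\<close> of the net. For a uniformly chosen point \<open>y\<close> of the net, let \<open>A\<^sub>i\<close> be the
  event that \<open>y\<close> lies in the same \<open>i\<close>-th cell as \<open>x\<close>. By the above, any \<open>2g + 1\<close> of these events
  are independent, and \<open>A\<^sub>i\<close> has probability \<open>1 / q\<^sub>i\<close>. So \<open>\<phi>\<^sub>i = q\<^sub>i \<chi>\<^sub>i - 1\<close>,
  where \<open>\<chi>\<^sub>i\<close> is the indicator of \<open>A\<^sub>i\<close>, has mean 0 and variance \<open>q\<^sub>i - 1\<close>, and the products \<open>\<phi>\<^sub>I = \<Prod>\<^bsub>i\<in>I\<^esub> \<phi>\<^sub>i\<close> are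
  pairwise orthogonal as long as the unions \<open>I \<union> J\<close> have at most \<open>2g + 1\<close> elements. A family
  with this property consists of all sets of size at most \<open>g\<close>, together with the sets of
  size \<open>g + 1\<close> through the single coordinate \<open>s\<close>: two of the latter share \<open>s\<close>, so that their
  union is small enough (\<open>card_Un_rao_family\<close>).

  The dimension count of Rao's bound can then be replaced by one evaluation
  (\<open>rao_bound_of_independent_events\<close>). Let \<open>f\<close> be the sum of all \<open>\<phi>\<^sub>I\<close> over the
  family, and let \<open>D\<close> be the sum of the products \<open>\<Prod>\<^bsub>i\<in>I\<^esub> (q\<^sub>i - 1)\<close>. Orthogonality gives
  \<open>\<Sum>\<^sub>y f(y)\<^sup>2 = N D\<close>, whereas the single term \<open>y = x\<close> contributes \<open>f(x)\<^sup>2 = D\<^sup>2\<close>. Hence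
  \<open>D \<le> N\<close>, which is the claim, because the empty set contributes 1 to \<open>D\<close>.
\<close>

section \<open>Rao's bound for partially independent events\<close>

text \<open>
  For independent events, the mean of a product of affine functions of their indicators is the
  product of the means. The independence hypothesis covers all subsets of \<open>K\<close> because
  multiplying out the product produces one term for each of them.
\<close>
lemma sum_prod_affine_of_independent:
  fixes q \<alpha> \<beta> :: "'i \<Rightarrow> real" and A :: "'i \<Rightarrow> 'k set"
  assumes "finite T" "finite K" and q: "\<And>i. i \<in> K \<Longrightarrow> q i \<noteq> 0"
    and indep: "\<And>L. L \<subseteq> K \<Longrightarrow> real (card {k \<in> T. \<forall>i\<in>L. k \<in> A i}) * (\<Prod>i\<in>L. q i) = real (card T)"
  shows "(\<Sum>k\<in>T. \<Prod>i\<in>K. \<alpha> i + \<beta> i * indicator (A i) k) = real (card T) * (\<Prod>i\<in>K. \<alpha> i + \<beta> i / q i)"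
proof -
  have indicator: "(\<Sum>k\<in>T. \<Prod>i\<in>L. indicator (A i) k) = real (card T) / (\<Prod>i\<in>L. q i)"
    if L: "L \<subseteq> K" for L
  proof -
    have finL: "finite L" using L \<open>finite K\<close> finite_subset by blast
    have "(\<Prod>i\<in>L. indicator (A i) k) = (if \<forall>i\<in>L. k \<in> A i then 1 else 0 :: real)" for k
      using finL by (auto simp: indicator_def prod_zero_iff)
    then have "(\<Sum>k\<in>T. \<Prod>i\<in>L. indicator (A i) k) = real (card {k \<in> T. \<forall>i\<in>L. k \<in> A i})"
      using \<open>finite T\<close> by (simp add: sum.If_cases Int_def)
    moreover have "(\<Prod>i\<in>L. q i) \<noteq> 0"
      using L q finL by (auto simp: prod_zero_iff)
    ultimately show ?thesis using indep[OF L] by (simp add: field_simps)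
  qed
  have "(\<Sum>k\<in>T. \<Prod>i\<in>K. \<alpha> i + \<beta> i * indicator (A i) k)
      = (\<Sum>k\<in>T. \<Sum>L\<in>Pow K. (\<Prod>i\<in>L. \<beta> i * indicator (A i) k) * (\<Prod>i\<in>K - L. \<alpha> i))"
    by (simp add: add.commute[of "\<alpha> _"] prod_add[OF \<open>finite K\<close>])
  also have "\<dots> = (\<Sum>L\<in>Pow K. \<Sum>k\<in>T. (\<Prod>i\<in>L. \<beta> i * indicator (A i) k) * (\<Prod>i\<in>K - L. \<alpha> i))"
    by (rule sum.swap)
  also have "\<dots> = (\<Sum>L\<in>Pow K. (\<Prod>i\<in>L. \<beta> i) * (\<Prod>i\<in>K - L. \<alpha> i) * (\<Sum>k\<in>T. \<Prod>i\<in>L. indicator (A i) k))"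
    by (simp add: prod.distrib sum_distrib_left mult_ac)
  also have "\<dots> = (\<Sum>L\<in>Pow K. real (card T) * ((\<Prod>i\<in>L. \<beta> i / q i) * (\<Prod>i\<in>K - L. \<alpha> i)))"
    by (rule sum.cong) (simp_all add: indicator prod_dividef)
  also have "\<dots> = real (card T) * (\<Prod>i\<in>K. \<alpha> i + \<beta> i / q i)"
    by (simp add: add.commute[of "\<alpha> _"] prod_add[OF \<open>finite K\<close>] sum_distrib_left)
  finally show ?thesis .
qed

text \<open>
  A factor with \<open>i\<close> in exactly one of \<open>I\<close> and \<open>J\<close> occurs once and has mean 0, so it kills the sum;
  a factor with \<open>i \<in> I \<inter> J\<close> occurs squared and has mean \<open>q i - 1\<close>.
\<close>
lemma sum_prod_centered_orthogonal:
  fixes q :: "'i \<Rightarrow> real" and A :: "'i \<Rightarrow> 'k set"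
  defines "\<phi> \<equiv> \<lambda>i k. q i * indicator (A i) k - 1"
  assumes "finite T" and finI: "finite I" and finJ: "finite J"
    and q: "\<And>i. i \<in> I \<union> J \<Longrightarrow> q i \<noteq> 0"
    and indep: "\<And>L. L \<subseteq> I \<union> J \<Longrightarrow> real (card {k \<in> T. \<forall>i\<in>L. k \<in> A i}) * (\<Prod>i\<in>L. q i) = real (card T)"
  shows "(\<Sum>k\<in>T. (\<Prod>i\<in>I. \<phi> i k) * (\<Prod>i\<in>J. \<phi> i k))
       = (if I = J then real (card T) * (\<Prod>i\<in>I. q i - 1) else 0)"
proof -
  \<comment> \<open>An indicator is idempotent, so \<open>(q i * indicator - 1)\<^sup>2\<close> is again affine in the indicator.\<close>
  define \<alpha> \<beta> :: "'i \<Rightarrow> real"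
    where "\<alpha> i = (if i \<in> I \<inter> J then 1 else - 1)"
      and "\<beta> i = (if i \<in> I \<inter> J then (q i)\<^sup>2 - 2 * q i else q i)" for i
  have fin: "finite (I \<union> J)" using finI finJ by simp
  have product: "(\<Prod>i\<in>I. \<phi> i k) * (\<Prod>i\<in>J. \<phi> i k) = (\<Prod>i\<in>I \<union> J. \<alpha> i + \<beta> i * indicator (A i) k)" for k
  proof -
    have "(\<Prod>i\<in>I. \<phi> i k) * (\<Prod>i\<in>J. \<phi> i k)
        = (\<Prod>i\<in>I \<union> J. (if i \<in> I then \<phi> i k else 1) * (if i \<in> J then \<phi> i k else 1))"
      using fin by (simp add: prod.distrib prod.If_cases Int_absorb1)
    also have "\<dots> = (\<Prod>i\<in>I \<union> J. \<alpha> i + \<beta> i * indicator (A i) k)"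
      by (rule prod.cong) (auto simp: \<phi>_def \<alpha>_def \<beta>_def indicator_def power2_eq_square algebra_simps)
    finally show ?thesis .
  qed
  have "(\<Sum>k\<in>T. (\<Prod>i\<in>I. \<phi> i k) * (\<Prod>i\<in>J. \<phi> i k)) = real (card T) * (\<Prod>i\<in>I \<union> J. \<alpha> i + \<beta> i / q i)"
    unfolding product
    by (rule sum_prod_affine_of_independent) (use \<open>finite T\<close> fin q indep in auto)
  also have "(\<Prod>i\<in>I \<union> J. \<alpha> i + \<beta> i / q i) = (\<Prod>i\<in>I \<union> J. if i \<in> I \<inter> J then q i - 1 else 0)"
    by (rule prod.cong) (use q in \<open>auto simp: \<alpha>_def \<beta>_def power2_eq_square field_simps\<close>)
  also have "real (card T) * \<dots> = (if I = J then real (card T) * (\<Prod>i\<in>I. q i - 1) else 0)"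
    using fin by (auto simp: prod_zero_iff intro!: prod.cong)
  finally show ?thesis .
qed

text \<open>
  The function \<open>f\<close> of the proof is a reproducing kernel with one argument fixed at \<open>k0\<close>: its
  square sum is \<open>card T\<close> times its own value at \<open>k0\<close>. Comparing that sum with its term at \<open>k0\<close>
  bounds the value.
\<close>
lemma rao_bound_of_independent_events:
  fixes q :: "'i \<Rightarrow> real" and A :: "'i \<Rightarrow> 'k set"
  assumes "finite T" "finite F"
    and fin: "\<And>I. I \<in> F \<Longrightarrow> finite I"
    and q: "\<And>I i. I \<in> F \<Longrightarrow> i \<in> I \<Longrightarrow> 1 \<le> q i"
    and k0: "k0 \<in> T" "\<And>I i. I \<in> F \<Longrightarrow> i \<in> I \<Longrightarrow> k0 \<in> A i"
    and indep: "\<And>I J L. I \<in> F \<Longrightarrow> J \<in> F \<Longrightarrow> L \<subseteq> I \<union> J \<Longrightarrow>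
       real (card {k \<in> T. \<forall>i\<in>L. k \<in> A i}) * (\<Prod>i\<in>L. q i) = real (card T)"
  shows "(\<Sum>I\<in>F. \<Prod>i\<in>I. q i - 1) \<le> real (card T)"
proof -
  define f where "f k = (\<Sum>I\<in>F. \<Prod>i\<in>I. q i * indicator (A i) k - 1)" for k
  define D where "D = (\<Sum>I\<in>F. \<Prod>i\<in>I. q i - 1)"
  have f_k0: "f k0 = D"
    unfolding f_def D_def by (intro sum.cong prod.cong) (auto simp: k0)
  have orth: "(\<Sum>k\<in>T. (\<Prod>i\<in>I. q i * indicator (A i) k - 1) * (\<Prod>i\<in>J. q i * indicator (A i) k - 1))
      = (if I = J then real (card T) * (\<Prod>i\<in>I. q i - 1) else 0)"
    if "I \<in> F" "J \<in> F" for I J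
  proof (rule sum_prod_centered_orthogonal)
    show "q i \<noteq> 0" if "i \<in> I \<union> J" for i
      using that q[of I i] q[of J i] \<open>I \<in> F\<close> \<open>J \<in> F\<close> by auto
  qed (use that \<open>finite T\<close> fin indep in auto)
  have "(\<Sum>k\<in>T. (f k)\<^sup>2) = (\<Sum>k\<in>T. \<Sum>I\<in>F. \<Sum>J\<in>F.
      (\<Prod>i\<in>I. q i * indicator (A i) k - 1) * (\<Prod>i\<in>J. q i * indicator (A i) k - 1))"
    by (simp add: f_def power2_eq_square sum_product)
  also have "\<dots> = (\<Sum>I\<in>F. \<Sum>J\<in>F. \<Sum>k\<in>T.
      (\<Prod>i\<in>I. q i * indicator (A i) k - 1) * (\<Prod>i\<in>J. q i * indicator (A i) k - 1))"
    by (subst sum.swap, rule sum.cong[OF refl], rule sum.swap)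
  also have "\<dots> = (\<Sum>I\<in>F. \<Sum>J\<in>F. if I = J then real (card T) * (\<Prod>i\<in>I. q i - 1) else 0)"
    by (intro sum.cong refl orth)
  also have "\<dots> = real (card T) * D"
    using \<open>finite F\<close> by (simp add: D_def sum_distrib_left)
  finally have sum_squares: "(\<Sum>k\<in>T. (f k)\<^sup>2) = real (card T) * D" .
  have "(f k0)\<^sup>2 \<le> (\<Sum>k\<in>T. (f k)\<^sup>2)"
    using \<open>finite T\<close> k0(1) by (intro member_le_sum) auto
  then have "D * D \<le> real (card T) * D"
    unfolding f_k0 sum_squares by (simp add: power2_eq_square)
  moreover have "0 \<le> D"
    unfolding D_def using q by (intro sum_nonneg prod_nonneg) force
  ultimately have "D \<le> real (card T)"
    by (cases "D = 0") (auto simp: mult_le_cancel_right)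
  then show ?thesis by (simp add: D_def)
qed

section \<open>Nets as orthogonal arrays\<close>

text \<open>
  Exchange argument: outside the top segment all values are at most \<open>e (s - t)\<close>, inside it they are
  at least \<open>e (s - t)\<close>, and \<open>K\<close> leaves at least as many indices of the segment unused as it takes
  from below.
\<close>
lemma sum_le_sum_top_of_mono:
  fixes e :: "nat \<Rightarrow> nat"
  assumes mono: "\<forall>i\<in>{1..s}. \<forall>j\<in>{1..s}. i \<le> j \<longrightarrow> e i \<le> e j"
    and K: "K \<subseteq> {1..s}" "card K \<le> Suc t" and t: "t < s"
  shows "(\<Sum>i\<in>K. e i) \<le> (\<Sum>i = s - t..s. e i)"
proof -
  define U where "U = {s - t..s}"
  have finK: "finite K" using K finite_subset by blast
  have finU: "finite U" and cardU: "card U = Suc t" using t by (auto simp: U_def)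
  have pivot: "s - t \<in> {1..s}" using t by simp
  have "card (K - U) \<le> card (U - K)"
    using card_Int_Diff[OF finK, of U] card_Int_Diff[OF finU, of K] K(2) cardU by (simp add: Int_commute)
  have "(\<Sum>i\<in>K - U. e i) \<le> card (K - U) * e (s - t)"
    using sum_bounded_above[of "K - U" e "e (s - t)"] mono K(1) pivot by (force simp: U_def)
  also have "\<dots> \<le> card (U - K) * e (s - t)"
    using \<open>card (K - U) \<le> card (U - K)\<close> by simp
  also have "\<dots> \<le> (\<Sum>i\<in>U - K. e i)"
    using sum_bounded_below[of "U - K" "e (s - t)" e] mono pivot by (force simp: U_def)
  finally have "(\<Sum>i\<in>K - U. e i) \<le> (\<Sum>i\<in>U - K. e i)" .
  then show ?thesis
    using sum.Int_Diff[OF finK, of e U] sum.Int_Diff[OF finU, of e K]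
    by (simp add: Int_commute U_def)
qed

lemma lebesgue_volume_elementary_box:
  assumes "0 < b"
  shows "lebesgue_volume s (elementary_box b s d a) = 1 / (\<Prod>i\<in>{1..s}. real b ^ d i)"
proof -
  interpret finite_product_sigma_finite "\<lambda>_::nat. lborel :: real measure" "{1..s}"
    by standard auto
  have "real (a i) / real b ^ d i \<le> (real (a i) + 1) / real b ^ d i" for i
    by (simp add: divide_right_mono)
  then have "emeasure (\<Pi>\<^sub>M i\<in>{1..s}. lborel) (elementary_box b s d a)
      = ennreal (\<Prod>i\<in>{1..s}. 1 / real b ^ d i)"
    unfolding elementary_box_def
    by (subst measure_times) (auto simp: prod_ennreal diff_divide_distrib[symmetric])
  then show ?thesis
    by (simp add: lebesgue_volume_def measure_def prod_nonneg prod_dividef)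
qed

lemma mem_elementary_interval_iff_floor:
  fixes x :: real
  assumes "0 < b"
  shows "x \<in> {real a / real b ^ d ..< (real a + 1) / real b ^ d} \<longleftrightarrow> \<lfloor>real b ^ d * x\<rfloor> = int a"
  using assms by (auto simp: floor_eq_iff field_simps)

text \<open>
  The cells of \<open>x\<close> in the directions of \<open>L\<close> bound an elementary box once the resolution is set to
  0 in all other directions, which puts no condition there. Its volume
  is large enough for the net property because the exponents in \<open>L\<close> sum to at most \<open>m\<close>.
\<close>
lemma net_cells_independent:
  assumes net: "is_net 0 m e s b P"
    and x: "x \<in> unit_cube s"
    and L: "L \<subseteq> {1..s}" "(\<Sum>i\<in>L. e i) \<le> m"
  shows "real (card {n \<in> {..<b ^ m}. \<forall>i\<in>L. n \<in> {n. \<lfloor>real b ^ e i * P n i\<rfloor> = \<lfloor>real b ^ e i * x i\<rfloor>}})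
           * (\<Prod>i\<in>L. real b ^ e i) = real (b ^ m)"
proof -
  define d where "d i = (if i \<in> L then e i else 0)" for i
  define a where "a i = nat \<lfloor>real b ^ d i * x i\<rfloor>" for i
  have b: "0 < b" using net by (simp add: is_net_def)
  have x_unit: "0 \<le> x i" "x i < 1" if "i \<in> {1..s}" for i
    using x that by (auto simp: unit_cube_def PiE_def Pi_def)
  have a_floor: "int (a i) = \<lfloor>real b ^ d i * x i\<rfloor>" if "i \<in> {1..s}" for i
    using x_unit[OF that] by (simp add: a_def)
  have a_less: "a i < b ^ d i" if "i \<in> {1..s}" for i
  proof -
    have "real b ^ d i * x i < real b ^ d i" using x_unit[OF that] b by simp
    then have "\<lfloor>real b ^ d i * x i\<rfloor> < int (b ^ d i)" by (simp add: floor_less_iff)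
    then have "int (a i) < int (b ^ d i)" using a_floor[OF that] by simp
    then show ?thesis by (simp only: of_nat_less_iff)
  qed
  have prod_d: "(\<Prod>i\<in>{1..s}. real b ^ d i) = (\<Prod>i\<in>L. real b ^ e i)"
    by (rule prod.mono_neutral_cong_right) (use L(1) in \<open>auto simp: d_def\<close>)
  have volume: "lebesgue_volume s (elementary_box b s d a) = 1 / (\<Prod>i\<in>L. real b ^ e i)"
    unfolding lebesgue_volume_elementary_box[OF b] prod_d ..
  have "(\<Prod>i\<in>L. real b ^ e i) \<le> real b ^ m"
    using L(2) b by (simp add: power_sum[symmetric] power_increasing)
  then have "real b powi (int 0 - int m) \<le> lebesgue_volume s (elementary_box b s d a)"
    using b by (simp add: volume power_int_minus field_simps prod_pos)
  moreover have "\<forall>i\<in>{1..s}. a i < b ^ d i \<and> e i dvd d i"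
    using a_less by (simp add: d_def)
  ultimately have "real (card {n. n < b ^ m \<and> P n \<in> elementary_box b s d a})
      = real b ^ m * lebesgue_volume s (elementary_box b s d a)"
    using net by (simp add: is_net_def)
  moreover have "P n \<in> elementary_box b s d a
      \<longleftrightarrow> (\<forall>i\<in>L. \<lfloor>real b ^ e i * P n i\<rfloor> = \<lfloor>real b ^ e i * x i\<rfloor>)" if "n < b ^ m" for n
  proof -
    have P: "P n \<in> unit_cube s" using net that by (simp add: is_net_def)
    have "P n \<in> elementary_box b s d a
        \<longleftrightarrow> (\<forall>i\<in>{1..s}. \<lfloor>real b ^ d i * P n i\<rfloor> = \<lfloor>real b ^ d i * x i\<rfloor>)"
      using P a_floor unfolding elementary_box_def unit_cube_def PiE_iff
      by (simp only: mem_elementary_interval_iff_floor[OF b]) auto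
    also have "\<dots> \<longleftrightarrow> (\<forall>i\<in>L. \<lfloor>real b ^ e i * P n i\<rfloor> = \<lfloor>real b ^ e i * x i\<rfloor>)"
    proof -
      have "\<lfloor>P n i\<rfloor> = \<lfloor>x i\<rfloor>" if "i \<in> {1..s}" for i
      proof -
        have "0 \<le> P n i" "P n i < 1"
          using P that by (auto simp: unit_cube_def PiE_def Pi_def)
        then have "\<lfloor>P n i\<rfloor> = 0" by linarith
        moreover have "\<lfloor>x i\<rfloor> = 0" using x_unit[OF that] by linarith
        ultimately show ?thesis by simp
      qed
      then show ?thesis using L(1) by (auto simp: d_def)
    qed
    finally show ?thesis .
  qed
  ultimately have "real (card {n. n < b ^ m \<and> (\<forall>i\<in>L. \<lfloor>real b ^ e i * P n i\<rfloor> = \<lfloor>real b ^ e i * x i\<rfloor>)})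
      = real b ^ m / (\<Prod>i\<in>L. real b ^ e i)"
    by (simp add: volume cong: conj_cong)
  moreover have "(\<Prod>i\<in>L. real b ^ e i) \<noteq> 0"
    using b by (intro prod_pos[THEN less_imp_neq, THEN not_sym]) simp
  ultimately show ?thesis by (simp add: field_simps)
qed

section \<open>The index family of odd strength\<close>

definition rao_family :: "nat \<Rightarrow> nat \<Rightarrow> nat set set" where
  "rao_family s g =
     {I. I \<subseteq> {1..s} \<and> card I \<le> g} \<union> insert s ` {I. I \<subseteq> {1..s - 1} \<and> card I = g}"

text \<open>
  Two sets of size \<open>g + 1\<close> in the family meet in \<open>s\<close>; in every other case one of the two sets has
  at most \<open>g\<close> elements.
\<close>
lemma card_Un_rao_family:
  assumes I: "I \<in> rao_family s g" and J: "J \<in> rao_family s g"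
  shows "card (I \<union> J) \<le> Suc (2 * g)"
proof -
  have low: "card X \<le> g \<or> (s \<in> X \<and> card X = Suc g)" if "X \<in> rao_family s g" for X
  proof -
    have "card (insert s Y) = Suc (card Y)" if "Y \<subseteq> {1..s - 1}" "1 \<le> s" for Y
      using that finite_subset[OF that(1)] by (subst card_insert_disjoint) force+
    moreover have "Y = {}" if "Y \<subseteq> {1..s - 1}" "s = 0" for Y
      using that by auto
    ultimately show ?thesis
      using that unfolding rao_family_def by (cases "s = 0") auto
  qed
  show ?thesis
  proof (cases "s \<in> I \<inter> J")
    case True
    have "finite I" "finite J"
      using I J by (auto simp: rao_family_def intro: finite_subset)
    then have "card (I \<union> J) + card (I \<inter> J) = card I + card J" "1 \<le> card (I \<inter> J)"
      using card_Un_Int[of I J] True by (auto simp: Suc_le_eq card_gt_0_iff)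
    then show ?thesis using low[OF I] low[OF J] by auto
  next
    case False
    then show ?thesis using low[OF I] low[OF J] card_Un_le[of I J] by auto
  qed
qed

lemma sum_prod_rao_family:
  fixes w :: "nat \<Rightarrow> 'a::comm_ring_1"
  assumes "1 \<le> s"
  shows "(\<Sum>I\<in>rao_family s g. \<Prod>i\<in>I. w i)
       = 1 + (\<Sum>j = 1..g. \<Sum>I | I \<subseteq> {1..s} \<and> card I = j. \<Prod>i\<in>I. w i)
           + w s * (\<Sum>I | I \<subseteq> {1..s - 1} \<and> card I = g. \<Prod>i\<in>I. w i)"
proof -
  let ?H = "{I. I \<subseteq> {1..s - 1} \<and> card I = g}"
  have s_notin: "s \<notin> I" "finite I" if "I \<in> ?H" for I
  proof -
    have "I \<subseteq> {1..s - 1}" using that by simp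
    then show "finite I" by (rule finite_subset) simp
    show "s \<notin> I"
    proof
      assume "s \<in> I"
      with \<open>I \<subseteq> {1..s - 1}\<close> have "s \<in> {1..s - 1}" by blast
      with assms show False by simp
    qed
  qed
  have fin: "finite ?H" "finite {I. I \<subseteq> {1..s} \<and> card I \<le> g}"
    by simp_all
  have disj: "{I. I \<subseteq> {1..s} \<and> card I \<le> g} \<inter> insert s ` ?H = {}"
  proof -
    have "card (insert s I) = Suc g" if "I \<in> ?H" for I
      using that s_notin[OF that] by simp
    then show ?thesis by force
  qed
  have inj: "inj_on (insert s) ?H"
  proof (rule inj_onI)
    fix I J assume "I \<in> ?H" "J \<in> ?H" and eq: "insert s I = insert s J"
    then have "s \<notin> I" "s \<notin> J" using s_notin(1) by blast+
    then show "I = J" using eq by (rule insert_ident[THEN iffD1])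
  qed
  have "(\<Sum>I\<in>insert s ` ?H. \<Prod>i\<in>I. w i) = w s * (\<Sum>I\<in>?H. \<Prod>i\<in>I. w i)"
    unfolding sum.reindex[OF inj] sum_distrib_left
    by (rule sum.cong) (simp_all del: mem_Collect_eq add: s_notin)
  moreover have "(\<Sum>I | I \<subseteq> {1..s} \<and> card I \<le> g. \<Prod>i\<in>I. w i)
      = 1 + (\<Sum>j = 1..g. \<Sum>I | I \<subseteq> {1..s} \<and> card I = j. \<Prod>i\<in>I. w i)"
  proof -
    have "(\<Sum>I | I \<subseteq> {1..s} \<and> card I \<le> g. \<Prod>i\<in>I. w i)
        = (\<Sum>j\<in>{0..g}. \<Sum>I | I \<in> {I. I \<subseteq> {1..s} \<and> card I \<le> g} \<and> card I = j. \<Prod>i\<in>I. w i)"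
      by (rule sum.group[symmetric]) (use fin in auto)
    also have "\<dots> = (\<Sum>j\<in>{0..g}. \<Sum>I | I \<subseteq> {1..s} \<and> card I = j. \<Prod>i\<in>I. w i)"
      by (intro sum.cong) auto
    also have "\<dots> = (\<Sum>I | I \<subseteq> {1..s} \<and> card I = 0. \<Prod>i\<in>I. w i)
        + (\<Sum>j = 1..g. \<Sum>I | I \<subseteq> {1..s} \<and> card I = j. \<Prod>i\<in>I. w i)"
      by (simp add: sum.atLeast_Suc_atMost)
    also have "{I. I \<subseteq> {1..s} \<and> card I = 0} = {{}}"
      by (auto simp: card_eq_0_iff dest: finite_subset)
    finally show ?thesis by simp
  qed
  ultimately show ?thesis
    unfolding rao_family_def using fin disj by (simp add: sum.union_disjoint)
qed

section \<open>The bound for nets\<close>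

theorem theorem3:
  fixes b s m g :: nat and e :: "nat \<Rightarrow> nat"
  assumes "2 \<le> b" and "3 \<le> s"
    and "\<forall>i\<in>{1..s}. 1 \<le> e i"
    and "\<forall>i\<in>{1..s}. \<forall>j\<in>{1..s}. i \<le> j \<longrightarrow> e i \<le> e j"
    and "1 \<le> g" and "real g \<le> (real s - 1) / 2"
    and "\<exists>P. is_net 0 m e s b P"
    and "m \<ge> (\<Sum>i = s - 2 * g..s. e i)"
  shows "(\<Sum>j = 1..g. \<Sum>I | I \<subseteq> {1..s} \<and> card I = j. \<Prod>i\<in>I. (int b ^ e i - 1))
           + (int b ^ e s - 1)
               * (\<Sum>I | I \<subseteq> {1..s - 1} \<and> card I = g. \<Prod>i\<in>I. (int b ^ e i - 1))
         \<le> int b ^ m - 1"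
proof -
  obtain P where net: "is_net 0 m e s b P" using assms(7) by blast
  have "real (2 * g + 1) \<le> real s" using assms(6) by (simp add: field_simps)
  then have g: "2 * g < s" by (simp only: of_nat_le_iff)
  have N_pos: "0 < b ^ m" using assms(1) by simp
  have P0: "P 0 \<in> unit_cube s" using net N_pos by (simp add: is_net_def)
  \<comment> \<open>The fixed point of the net is the one with index 0, which exists because \<open>b ^ m\<close> is positive.\<close>
  define A where "A i = {n. \<lfloor>real b ^ e i * P n i\<rfloor> = \<lfloor>real b ^ e i * P 0 i\<rfloor>}" for i
  have family: "I \<subseteq> {1..s}" if "I \<in> rao_family s g" for I
    using that assms(2) by (fastforce simp: rao_family_def)
  have "(\<Sum>I\<in>rao_family s g. \<Prod>i\<in>I. real b ^ e i - 1) \<le> real (card {..<b ^ m})"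
  proof (rule rao_bound_of_independent_events[where A = A and ?k0.0 = 0])
    show "finite (rao_family s g)"
      by (rule finite_subset[of _ "Pow {1..s}"]) (use family in auto)
    show "finite I" if "I \<in> rao_family s g" for I
      using family[OF that] finite_subset by blast
    show "1 \<le> real b ^ e i" for i using assms(1) by simp
    show "(0::nat) \<in> {..<b ^ m}" using N_pos by simp
    show "0 \<in> A i" for i by (simp add: A_def)
    fix I J L assume IJ: "I \<in> rao_family s g" "J \<in> rao_family s g" and L: "L \<subseteq> I \<union> J"
    have L_sub: "L \<subseteq> {1..s}" using L family IJ by blast
    have "finite (I \<union> J)" using family IJ finite_subset by blast
    then have "card L \<le> Suc (2 * g)"
      using card_mono[OF _ L] card_Un_rao_family[OF IJ] by simp
    then have "(\<Sum>i\<in>L. e i) \<le> m"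
      using sum_le_sum_top_of_mono[OF assms(4) L_sub _ g] assms(8) by simp
    then show "real (card {k \<in> {..<b ^ m}. \<forall>i\<in>L. k \<in> A i}) * (\<Prod>i\<in>L. real b ^ e i)
        = real (card {..<b ^ m})"
      unfolding A_def using net_cells_independent[OF net P0 L_sub] by simp
  qed simp
  then have "real_of_int (\<Sum>I\<in>rao_family s g. \<Prod>i\<in>I. int b ^ e i - 1) \<le> real_of_int (int b ^ m)"
    by simp
  then have "(\<Sum>I\<in>rao_family s g. \<Prod>i\<in>I. int b ^ e i - 1) \<le> int b ^ m"
    by (simp only: of_int_le_iff)
  then show ?thesis
    using assms(2) by (simp add: sum_prod_rao_family)
qed

end
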